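(* Let $L$ be a non-Lie complex filiform Leibniz algebra in $SLeib_6$. Then $L$ is isomorphic to one of the following pairwise non-isomorphic Leibniz algebras: 1) $L(1,0,\lambda,1)$, $\lambda\in\mathbb{C}$; 2) $L(1,0,1,0)$; 3) $L(1,0,0,0)$; 4) $L(0,1,0,1)$; 5) $L(0,1,1,0)$; 6) $L(0,1,0,0)$; 7) $L(0,0,0,1)$; 8) $L(0,0,1,0)$; 9) $L(0,0,0,0)$.
   Context: A Leibniz algebra is a vector space with a bilinear product satisfying $[x,[y,z]]=[[x,y],z]-[[x,z],y]$. Put $L^1=L$, $L^{k+1}=[L^k,L]$; an $m$-dimensional Leibniz algebra $L$ is filiform if $\dim L^i=m-i$ for $2\le i\le m$. For $(\beta_3,\beta_4,\beta_5,\gamma)\in\mathbb{C}^4$, $L(\beta_3,\beta_4,\beta_5,\gamma)$ denotes the 6-dimensional complex Leibniz algebra with basis $e_0,\dots,e_5$ and products $[e_0,e_0]=e_2$, $[e_i,e_0]=e_{i+1}$ for $2\le i\le 4$, $[e_0,e_1]=\beta_3e_3+\beta_4e_4+\beta_5e_5$, $[e_1,e_1]=\gamma e_5$, $[e_2,e_1]=\beta_3e_4+\beta_4e_5$, $[e_3,e_1]=\beta_3e_5$, all other products of basis vectors being zero. $SLeib_6$ is the class of 6-dimensional non-Lie complex filiform Leibniz algebras that admit a basis with such a multiplication table for some $(\beta_3,\beta_4,\beta_5,\gamma)$. *)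

theory Defs
  imports "HOL-Analysis.Analysis"
begin

locale leibniz_algebra = vector_space sc
  for sc :: "'k::field \<Rightarrow> 'v::ab_group_add \<Rightarrow> 'v" +
  fixes br :: "'v \<Rightarrow> 'v \<Rightarrow> 'v"
  assumes linear_right: "Vector_Spaces.linear sc sc (br x)"
    and linear_left: "Vector_Spaces.linear sc sc (\<lambda>x. br x y)"
    and leibniz: "br x (br y z) = br (br x y) z - br (br x z) y"
begin

text \<open>The series is indexed from 1; the value at 0 is a dummy.\<close>

fun lcs :: "nat \<Rightarrow> 'v set" where
  "lcs 0 = UNIV"
| "lcs (Suc 0) = UNIV"
| "lcs (Suc (Suc k)) = span {br x y | x y. x \<in> lcs (Suc k)}"

definition is_lie :: bool where
  "is_lie \<longleftrightarrow> (\<forall>x. br x x = 0) \<and>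
     (\<forall>x y z. br x (br y z) + br y (br z x) + br z (br x y) = 0)"

text \<open>Finite dimensionality is explicit because \<^term>\<open>dim\<close> is 0 on infinite-dimensional spaces.\<close>

definition filiform :: bool where
  "filiform \<longleftrightarrow> (\<exists>B. finite B \<and> span B = UNIV) \<and>
     (\<forall>i. 2 \<le> i \<and> i \<le> dim UNIV \<longrightarrow> dim (lcs i) = dim UNIV - i)"

end

definition leibniz_iso ::
  "('k::field \<Rightarrow> 'v::ab_group_add \<Rightarrow> 'v) \<Rightarrow> ('v \<Rightarrow> 'v \<Rightarrow> 'v) \<Rightarrow>
   ('k \<Rightarrow> 'w::ab_group_add \<Rightarrow> 'w) \<Rightarrow> ('w \<Rightarrow> 'w \<Rightarrow> 'w) \<Rightarrow> bool" where
  "leibniz_iso s1 b1 s2 b2 \<longleftrightarrow>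
     (\<exists>f. Vector_Spaces.linear s1 s2 f \<and> bij f \<and> (\<forall>x y. f (b1 x y) = b2 (f x) (f y)))"

type_synonym params = "complex \<times> complex \<times> complex \<times> complex"

text \<open>\<open>sleib_table sc e (\<beta>\<^sub>3, \<beta>\<^sub>4, \<beta>\<^sub>5, \<gamma>) i j\<close> is the prescribed value of \<open>[e\<^sub>i, e\<^sub>j]\<close>;
  it is meant for \<open>i, j \<le> 5\<close> only.\<close>

fun sleib_table ::
  "(complex \<Rightarrow> 'v::ab_group_add \<Rightarrow> 'v) \<Rightarrow> (nat \<Rightarrow> 'v) \<Rightarrow> params \<Rightarrow> nat \<Rightarrow> nat \<Rightarrow> 'v" where
  "sleib_table sc e (\<beta>3, \<beta>4, \<beta>5, \<gamma>) i j =
     (if i = 0 \<and> j = 0 then e 2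
      else if 2 \<le> i \<and> i \<le> 4 \<and> j = 0 then e (i + 1)
      else if i = 0 \<and> j = 1 then sc \<beta>3 (e 3) + sc \<beta>4 (e 4) + sc \<beta>5 (e 5)
      else if i = 1 \<and> j = 1 then sc \<gamma> (e 5)
      else if i = 2 \<and> j = 1 then sc \<beta>3 (e 4) + sc \<beta>4 (e 5)
      else if i = 3 \<and> j = 1 then sc \<beta>3 (e 5)
      else 0)"

locale sleib6 = leibniz_algebra sc br
  for sc :: "complex \<Rightarrow> 'v::ab_group_add \<Rightarrow> 'v" and br :: "'v \<Rightarrow> 'v \<Rightarrow> 'v" +
  assumes dim6: "dim UNIV = 6"
    and non_lie: "\<not> is_lie"
    and filiform: "filiform"
    and sleib_basis: "\<exists>e p. inj_on e {0..5} \<and> independent (e ` {0..5}) \<and> span (e ` {0..5}) = UNIV \<and>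
          (\<forall>i\<le>5. \<forall>j\<le>5. br (e i) (e j) = sleib_table sc e p i j)"

text \<open>The algebra \<open>L(\<beta>\<^sub>3, \<beta>\<^sub>4, \<beta>\<^sub>5, \<gamma>)\<close> lives on \<^typ>\<open>complex ^ 6\<close>. The index type \<^typ>\<open>6\<close> is
  \<open>{0, \<dots>, 5}\<close> (integers modulo 6), so the standard basis vectors carry the indices 0 to 5.\<close>

definition std_basis :: "nat \<Rightarrow> complex ^ 6" where
  "std_basis i = axis (of_nat i) 1"

definition L_bracket :: "params \<Rightarrow> complex ^ 6 \<Rightarrow> complex ^ 6 \<Rightarrow> complex ^ 6" where
  "L_bracket p x y =
     (\<Sum>i\<le>5. \<Sum>j\<le>5. (x $ of_nat i * y $ of_nat j) *s sleib_table (*s) std_basis p i j)"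

definition sleib6_list :: "params set" where
  "sleib6_list = {(1, 0, t, 1) | t. True} \<union>
     {(1, 0, 1, 0), (1, 0, 0, 0), (0, 1, 0, 1), (0, 1, 1, 0), (0, 1, 0, 0),
      (0, 0, 0, 1), (0, 0, 1, 0), (0, 0, 0, 0)}"

end

theory Submission
  imports Defs
begin

text \<open>The algebra is generated by \<open>e\<^sub>0\<close> and \<open>e\<^sub>1\<close>, so an isomorphism is determined by
  the images \<open>e\<^sub>0' = A e\<^sub>0 + B e\<^sub>1 + \<dots>\<close> and \<open>e\<^sub>1'\<close>. The relation \<open>[e\<^sub>1', e\<^sub>0'] = 0\<close> forces
  \<open>e\<^sub>1' = D e\<^sub>1 - (B D \<gamma> / A) e\<^sub>4 + c e\<^sub>5\<close>, and comparing coordinates in the remaining products yields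
  necessary relations between the old and the new parameters in which only \<open>A\<close>, \<open>B\<close>, \<open>D\<close> occur.
  Two families of base changes, \<open>B = 0\<close> (scaling) and \<open>A = D = 1\<close> (shear), suffice to reach
  the normal forms, and the relations separate these.\<close>

section \<open>Coordinates on \<open>complex^6\<close> and the bracket in coordinates\<close>

lemma forall_6: "(\<forall>i::6. P i) \<longleftrightarrow> P 0 \<and> P 1 \<and> P 2 \<and> P 3 \<and> P 4 \<and> P 5"
proof
  assume *: "P 0 \<and> P 1 \<and> P 2 \<and> P 3 \<and> P 4 \<and> P 5"
  show "\<forall>i. P i"
  proof
    fix i :: 6
    obtain z where z: "i = of_int z" "0 \<le> z" "z < 6" by (cases i) auto
    then have "z \<in> {0, 1, 2, 3, 4, 5}" by auto
    with z * show "P i" by auto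
  qed
qed auto

lemma vec6_eq_iff:
  "(x::'a^6) = y \<longleftrightarrow> x$0 = y$0 \<and> x$1 = y$1 \<and> x$2 = y$2 \<and> x$3 = y$3 \<and> x$4 = y$4 \<and> x$5 = y$5"
  by (simp add: vec_eq_iff forall_6)

text \<open>Turns every identity between brackets into polynomial identities in the
  coordinates.\<close>

lemma L_bracket_nth:
  "L_bracket (b3, b4, b5, g) x y $ 0 = 0"
  "L_bracket (b3, b4, b5, g) x y $ 1 = 0"
  "L_bracket (b3, b4, b5, g) x y $ 2 = x$0 * y$0"
  "L_bracket (b3, b4, b5, g) x y $ 3 = x$2 * y$0 + b3 * x$0 * y$1"
  "L_bracket (b3, b4, b5, g) x y $ 4 = x$3 * y$0 + b4 * x$0 * y$1 + b3 * x$2 * y$1"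
  "L_bracket (b3, b4, b5, g) x y $ 5 =
     x$4 * y$0 + b5 * x$0 * y$1 + g * x$1 * y$1 + b4 * x$2 * y$1 + b3 * x$3 * y$1"
  by (simp_all add: L_bracket_def std_basis_def axis_def eval_nat_numeral atMost_Suc algebra_simps)


lemma leibniz_algebra_L_bracket: "leibniz_algebra (*s) (L_bracket p)"
proof -
  obtain b3 b4 b5 g where p: "p = (b3, b4, b5, g)" by (cases p) auto
  show ?thesis unfolding p
    by unfold_locales (simp_all add: Vector_Spaces.linear_iff vec.vector_space_axioms vec6_eq_iff
        L_bracket_nth algebra_simps)
qed

section \<open>Isomorphism as an equivalence relation\<close>

lemma leibniz_iso_refl: "vector_space s \<Longrightarrow> leibniz_iso s b s b"
  unfolding leibniz_iso_def Vector_Spaces.linear_iff by (rule exI [of _ id]) auto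

lemma leibniz_iso_sym:
  assumes "leibniz_iso s1 b1 s2 b2"
  shows "leibniz_iso s2 b2 s1 b1"
proof -
  obtain f where lin: "Vector_Spaces.linear s1 s2 f" and f: "bij f"
    and hom: "\<And>x y. f (b1 x y) = b2 (f x) (f y)"
    using assms unfolding leibniz_iso_def by blast
  have inv_eq: "inv f y = x \<longleftrightarrow> y = f x" for x y
    using f by (metis bij_inv_eq_iff)
  have [simp]: "f (inv f y) = y" for y
    using f by (simp add: bij_is_surj surj_f_inv_f)
  have "Vector_Spaces.linear s2 s1 (inv f)"
    using lin unfolding Vector_Spaces.linear_iff by (simp add: inv_eq)
  moreover have "inv f (b2 x y) = b1 (inv f x) (inv f y)" for x y
    by (simp add: inv_eq hom)
  ultimately show ?thesis
    unfolding leibniz_iso_def using f bij_imp_bij_inv by blast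
qed

lemma leibniz_iso_trans [trans]:
  assumes "leibniz_iso s1 b1 s2 b2" and "leibniz_iso s2 b2 s3 b3"
  shows "leibniz_iso s1 b1 s3 b3"
proof -
  obtain f g where "Vector_Spaces.linear s1 s2 f" "bij f" "\<And>x y. f (b1 x y) = b2 (f x) (f y)"
    and "Vector_Spaces.linear s2 s3 g" "bij g" "\<And>x y. g (b2 x y) = b3 (g x) (g y)"
    using assms unfolding leibniz_iso_def by metis
  then show ?thesis
    unfolding leibniz_iso_def
    by (intro exI [of _ "g \<circ> f"] conjI Vector_Spaces.linear_compose bij_comp) auto
qed

abbreviation L_iso :: "params \<Rightarrow> params \<Rightarrow> bool" where
  "L_iso p q \<equiv> leibniz_iso (*s) (L_bracket p) (*s) (L_bracket q)"

text \<open>By finite dimension an injective linear endomorphism is onto, so a trivial kernel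
  suffices.\<close>

lemma L_isoI:
  assumes lin: "Vector_Spaces.linear (*s) (*s) f" and ker: "\<And>x. f x = 0 \<Longrightarrow> x = 0"
    and hom: "\<And>x y. f (L_bracket p x y) = L_bracket q (f x) (f y)"
  shows "L_iso p q"
proof -
  have "inj f"
    using lin ker by (auto simp: vec.linear_inj_iff_eq_0)
  moreover from lin this have "surj f"
    by (rule vec.linear_inj_imp_surj)
  ultimately show ?thesis
    using lin hom unfolding leibniz_iso_def bij_def by blast
qed

section \<open>The two families of base changes\<close>

definition vec6 :: "'a \<Rightarrow> 'a \<Rightarrow> 'a \<Rightarrow> 'a \<Rightarrow> 'a \<Rightarrow> 'a \<Rightarrow> 'a^6" where
  "vec6 a0 a1 a2 a3 a4 a5 = (\<chi> i. if i = 0 then a0 else if i = 1 then a1 else if i = 2 then a2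
     else if i = 3 then a3 else if i = 4 then a4 else a5)"

lemma vec6_nth [simp]:
  "vec6 a0 a1 a2 a3 a4 a5 $ 0 = a0" "vec6 a0 a1 a2 a3 a4 a5 $ 1 = a1"
  "vec6 a0 a1 a2 a3 a4 a5 $ 2 = a2" "vec6 a0 a1 a2 a3 a4 a5 $ 3 = a3"
  "vec6 a0 a1 a2 a3 a4 a5 $ 4 = a4" "vec6 a0 a1 a2 a3 a4 a5 $ 5 = a5"
  by (simp_all add: vec6_def)

text \<open>The change of generators \<open>e\<^sub>0' = A e\<^sub>0\<close>, \<open>e\<^sub>1' = D e\<^sub>1\<close>.\<close>

lemma L_iso_scale:
  assumes "A \<noteq> 0" "D \<noteq> 0"
    and "D * b3 = A^2 * b3'" "D * b4 = A^3 * b4'" "D * b5 = A^4 * b5'" "D^2 * g = A^5 * g'"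
  shows "L_iso (b3, b4, b5, g) (b3', b4', b5', g')"
proof -
  \<comment> \<open>\<open>?f\<close> writes the new basis in the old one, so it maps from the
    primed algebra; symmetry reverses it at the end.\<close>
  let ?f = "\<lambda>v :: complex^6. vec6 (A * v$0) (D * v$1) (A^2 * v$2) (A^3 * v$3) (A^4 * v$4) (A^5 * v$5)"
  have e: "b3 = A^2 * b3' / D" "b4 = A^3 * b4' / D" "b5 = A^4 * b5' / D" "g = A^5 * g' / D^2"
    using assms by (simp_all add: field_simps)
  have "L_iso (b3', b4', b5', g') (b3, b4, b5, g)"
  proof (rule L_isoI [of ?f])
    show "Vector_Spaces.linear (*s) (*s) ?f"
      by (simp add: Vector_Spaces.linear_iff vec.vector_space_axioms vec6_eq_iff algebra_simps)
    show "?f x = 0 \<Longrightarrow> x = 0" for x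
      using assms(1,2) by (simp add: vec6_eq_iff)
    show "?f (L_bracket (b3', b4', b5', g') x y) = L_bracket (b3, b4, b5, g) (?f x) (?f y)" for x y
      using assms(1,2) unfolding e
      by (simp add: vec6_eq_iff L_bracket_nth field_simps eval_nat_numeral)
  qed
  then show ?thesis by (rule leibniz_iso_sym)
qed

text \<open>The change of generators \<open>e\<^sub>0' = e\<^sub>0 + B e\<^sub>1\<close>, \<open>e\<^sub>1' = e\<^sub>1 - B \<gamma> e\<^sub>4\<close>; the correction term
  restores \<open>[e\<^sub>1', e\<^sub>0'] = 0\<close>.\<close>

lemma L_iso_shear:
  assumes "b4' = b4 - 2 * B * b3^2"
    and "b5' = b5 + B * g - b3 * (B^2 * b3^2 + 2 * B * b4) - 3 * B * b3 * b4'"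
  shows "L_iso (b3, b4, b5, g) (b3, b4', b5', g)"
proof -
  \<comment> \<open>The images of \<open>e\<^sub>2\<close> to \<open>e\<^sub>5\<close> arise from
    the square of \<open>e\<^sub>0 + B e\<^sub>1\<close> by repeated right multiplication with it.
    The assumptions are coordinates 4 and 5 of \<open>[e\<^sub>0', e\<^sub>1']\<close>, solved for
    \<open>b4'\<close> and \<open>b5'\<close>.\<close>
  let ?f = "\<lambda>v :: complex^6. vec6 (v$0) (B * v$0 + v$1) (v$2) (B * b3 * v$2 + v$3)
    (- B * g * v$1 + B * b4 * v$2 + 2 * B * b3 * v$3 + v$4)
    ((B * b5 + B^2 * g) * v$2 + (2 * B * b4 + B^2 * b3^2) * v$3 + 3 * B * b3 * v$4 + v$5)"
  have "L_iso (b3, b4', b5', g) (b3, b4, b5, g)"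
  proof (rule L_isoI [of ?f])
    show "Vector_Spaces.linear (*s) (*s) ?f"
      by (simp add: Vector_Spaces.linear_iff vec.vector_space_axioms vec6_eq_iff algebra_simps)
    show "?f x = 0 \<Longrightarrow> x = 0" for x
      by (auto simp: vec6_eq_iff)
    show "?f (L_bracket (b3, b4', b5', g) x y) = L_bracket (b3, b4, b5, g) (?f x) (?f y)" for x y
      by (simp add: assms vec6_eq_iff L_bracket_nth) algebra
  qed
  then show ?thesis by (rule leibniz_iso_sym)
qed

section \<open>Reduction to the normal forms\<close>

lemma L_iso_sleib6_list: "\<exists>q\<in>sleib6_list. L_iso p q"
proof -
  obtain b3 b4 b5 g where p: "p = (b3, b4, b5, g)" by (cases p) auto
  have 1: "\<exists>q\<in>sleib6_list. L_iso (b3, 0, c, g) q" if "b3 \<noteq> 0" for c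
  proof (cases "g = 0")
    case False
    \<comment> \<open>The witnesses solve \<open>D * b3 = A^2\<close> and
      \<open>D^2 * g = A^5\<close>. Those of the later cases arise likewise from the parameters to
      be made 1; if there is only one such parameter, a free choice remains.\<close>
    have "L_iso (b3, 0, c, g) (1, 0, c * b3^3 / g^2, 1)"
      using that False
      by (intro L_iso_scale [where A = "g / b3^2" and D = "g^2 / b3^5"])
        (simp_all add: field_simps eval_nat_numeral)
    then show ?thesis unfolding sleib6_list_def by blast
  next
    case True
    show ?thesis
    proof (cases "c = 0")
      case False
      \<comment> \<open>\<open>D * b3 = A^2\<close> and \<open>D * c = A^4\<close> force
        \<open>A^2 = c / b3\<close>, so a complex square root is taken.\<close>
      define A where "A = csqrt (c / b3)"
      have "A^2 = c / b3" by (simp add: A_def)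
      moreover from this have "A^4 = (c / b3)^2"
        using power_mult [of A 2 2] by simp
      ultimately have "L_iso (b3, 0, c, g) (1, 0, 1, 0)"
        using that False True
        by (intro L_iso_scale [where A = A and D = "c / b3^2"]) (auto simp: power2_eq_square)
      then show ?thesis unfolding sleib6_list_def by blast
    next
      assume "c = 0"
      then have "L_iso (b3, 0, c, g) (1, 0, 0, 0)"
        using that True by (intro L_iso_scale [where A = 1 and D = "1 / b3"]) simp_all
      then show ?thesis unfolding sleib6_list_def by blast
    qed
  qed
  have 2: "\<exists>q\<in>sleib6_list. L_iso (0, b4, 0, g) q" if "g \<noteq> 0"
  proof (cases "b4 = 0")
    case True
    have "L_iso (0, b4, 0, g) (0, 0, 0, 1)"
      using that True
      by (intro L_iso_scale [where A = g and D = "g^2"]) (simp_all flip: power_mult power_Suc2)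
    then show ?thesis unfolding sleib6_list_def by blast
  next
    case False
    have "L_iso (0, b4, 0, g) (0, 1, 0, 1)"
      using that False
      by (intro L_iso_scale [where A = "b4^2 / g" and D = "b4^5 / g^3"])
        (simp_all add: field_simps eval_nat_numeral)
    then show ?thesis unfolding sleib6_list_def by blast
  qed
  have 3: "\<exists>q\<in>sleib6_list. L_iso (0, b4, b5, 0) q"
  proof -
    consider "b4 \<noteq> 0" "b5 \<noteq> 0" | "b4 \<noteq> 0" "b5 = 0" | "b4 = 0" "b5 \<noteq> 0" | "b4 = 0" "b5 = 0"
      by blast
    then show ?thesis
    proof cases
      case 1
      then have "L_iso (0, b4, b5, 0) (0, 1, 1, 0)"
        by (intro L_iso_scale [where A = "b5 / b4" and D = "b5^3 / b4^4"])
          (simp_all add: field_simps eval_nat_numeral)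
      then show ?thesis unfolding sleib6_list_def by blast
    next
      case 2
      then have "L_iso (0, b4, b5, 0) (0, 1, 0, 0)"
        by (intro L_iso_scale [where A = 1 and D = "1 / b4"]) simp_all
      then show ?thesis unfolding sleib6_list_def by blast
    next
      case 3
      then have "L_iso (0, b4, b5, 0) (0, 0, 1, 0)"
        by (intro L_iso_scale [where A = 1 and D = "1 / b5"]) simp_all
      then show ?thesis unfolding sleib6_list_def by blast
    next
      case 4
      then have "L_iso (0, b4, b5, 0) (0, 0, 0, 0)"
        by (simp add: leibniz_iso_refl vec.vector_space_axioms)
      then show ?thesis unfolding sleib6_list_def by blast
    qed
  qed
  consider "b3 \<noteq> 0" | "b3 = 0" "g \<noteq> 0" | "b3 = 0" "g = 0" by blast
  then show ?thesis
  proof cases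
    case b3: 1
    \<comment> \<open>This shear removes \<open>b4\<close>; the new third parameter is left as some
      \<open>c\<close>, which fact \<open>1\<close> allows.\<close>
    have "0 = b4 - 2 * (b4 / (2 * b3^2)) * b3^2" using b3 by simp
    from L_iso_shear [OF this refl] obtain c where "L_iso p (b3, 0, c, g)"
      unfolding p by blast
    then show ?thesis using 1 [OF b3] leibniz_iso_trans by blast
  next
    case b3: 2
    \<comment> \<open>For \<open>b3 = 0\<close> a shear fixes \<open>b4\<close> and adds
      \<open>B * g\<close> to \<open>b5\<close>.\<close>
    have "L_iso p (0, b4, 0, g)"
      unfolding p b3(1) using b3(2) by (intro L_iso_shear [where B = "- b5 / g"]) simp_all
    then show ?thesis using 2 [OF b3(2)] leibniz_iso_trans by blast
  next
    case b3: 3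
    then show ?thesis using 3 p by simp
  qed
qed

section \<open>Necessary relations and pairwise non-isomorphism\<close>

text \<open>\<open>A\<close> and \<open>B\<close> are coordinates 0 and 1 of the image of
  \<open>e\<^sub>0\<close>, and \<open>D\<close> is coordinate 1 of the image of
  \<open>e\<^sub>1\<close>. The images of \<open>e\<^sub>2\<close> to \<open>e\<^sub>5\<close> are
  triangular with diagonal \<open>A^2\<close> to \<open>A^5\<close>, and the relations are read off
  from \<open>[e\<^sub>0, e\<^sub>1]\<close> and \<open>[e\<^sub>1, e\<^sub>1]\<close>.\<close>

lemma L_iso_relations:
  assumes "L_iso (b3', b4', b5', g') (b3, b4, b5, g)"
  obtains A B D where "A \<noteq> 0" "D \<noteq> 0"
    "D * b3 = b3' * A^2"
    "D * b4 = 2 * A * B * b3 * b3' + b4' * A^3"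
    "D * (A * b5 + B * g) =
       A * (b3' * (B^2 * b3^2 + 2 * A * B * b4) + 3 * b4' * A^2 * B * b3 + b5' * A^4)"
    "D^2 * g = g' * A^5"
proof -
  let ?p = "(b3', b4', b5', g')" and ?q = "(b3, b4, b5, g)"
  obtain f where lin: "Vector_Spaces.linear (*s) (*s) f" and f: "inj f"
    and hom: "\<And>x y. f (L_bracket ?p x y) = L_bracket ?q (f x) (f y)"
    using assms unfolding leibniz_iso_def bij_def by blast
  have f_add: "f (x + y) = f x + f y" and f_scale: "f (c *s x) = c *s f x" for x y c
    using lin by (simp_all add: Vector_Spaces.linear_iff)
  have f0: "f 0 = 0" using f_scale [of 0 0] by simp
  define E where "E i = f (std_basis i)" for i
  have std: "std_basis 0 = vec6 1 0 0 0 0 0" "std_basis (Suc 0) = vec6 0 1 0 0 0 0"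
    "std_basis 2 = vec6 0 0 1 0 0 0" "std_basis 3 = vec6 0 0 0 1 0 0"
    "std_basis 4 = vec6 0 0 0 0 1 0" "std_basis 5 = vec6 0 0 0 0 0 1"
    by (simp_all add: std_basis_def vec6_eq_iff axis_def)
  have "L_bracket ?p (std_basis 0) (std_basis 0) = std_basis 2"
    "L_bracket ?p (std_basis 2) (std_basis 0) = std_basis 3"
    "L_bracket ?p (std_basis 3) (std_basis 0) = std_basis 4"
    "L_bracket ?p (std_basis 4) (std_basis 0) = std_basis 5"
    "L_bracket ?p (std_basis 1) (std_basis 0) = 0"
    "L_bracket ?p (std_basis 1) (std_basis 1) = g' *s std_basis 5"
    "L_bracket ?p (std_basis 0) (std_basis 1) =
       b3' *s std_basis 3 + b4' *s std_basis 4 + b5' *s std_basis 5"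
    by (simp_all add: std vec6_eq_iff L_bracket_nth)
  note this [THEN arg_cong [of _ _ f], unfolded hom f_add f_scale f0, folded E_def]
  \<comment> \<open>Entries 5, 6 and 7 come from \<open>[e\<^sub>1, e\<^sub>0] = 0\<close>,
    \<open>[e\<^sub>1, e\<^sub>1]\<close> and \<open>[e\<^sub>0, e\<^sub>1]\<close>.\<close>
  note coords = this [unfolded vec6_eq_iff L_bracket_nth vector_add_component vector_smult_component
      zero_index]
  define A B D where "A = E 0 $ 0" and "B = E 0 $ 1" and "D = E 1 $ 1"
  have pow: "A^3 = A^2 * A" "A^4 = A^3 * A" "A^5 = A^4 * A"
    by (simp_all add: eval_nat_numeral)
  have E2: "E 2 $ 0 = 0" "E 2 $ 1 = 0" "E 2 $ 2 = A^2"
    using coords unfolding A_def by (simp_all add: power2_eq_square)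
  have E3: "E 3 $ 0 = 0" "E 3 $ 1 = 0" "E 3 $ 2 = 0" "E 3 $ 3 = A^3"
    using coords E2 unfolding pow by (simp_all add: A_def)
  have E4: "E 4 $ 0 = 0" "E 4 $ 1 = 0" "E 4 $ 2 = 0" "E 4 $ 3 = 0" "E 4 $ 4 = A^4"
    using coords E3 unfolding pow by (simp_all add: A_def)
  have E5: "E 5 $ 0 = 0" "E 5 $ 1 = 0" "E 5 $ 2 = 0" "E 5 $ 3 = 0" "E 5 $ 4 = 0" "E 5 $ 5 = A^5"
    using coords E4 unfolding pow by (simp_all add: A_def)
  have "std_basis 5 \<noteq> (0 :: complex^6)" by (simp add: std vec6_eq_iff)
  then have "E 5 \<noteq> 0" using injD [OF f, of "std_basis 5" 0] f0 unfolding E_def by auto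
  then have A: "A \<noteq> 0" using E5 by (auto simp: vec6_eq_iff)
  \<comment> \<open>Coordinates 2 to 5 of \<open>[e\<^sub>1', e\<^sub>0'] = 0\<close>, in
    turn.\<close>
  have E10: "E 1 $ 0 = 0" using coords(5) A by (simp add: A_def)
  then have E12: "E 1 $ 2 = 0" using coords(5) A by (simp add: A_def)
  with E10 have E13: "E 1 $ 3 = 0" using coords(5) A by (simp add: A_def)
  have E14: "E 1 $ 4 * A + g * D * B = 0"
    using coords(5) E10 E12 E13 by (simp add: A_def B_def D_def)
  note E1 = E10 E12 E13 E14
  \<comment> \<open>If \<open>D = 0\<close>, then \<open>E14\<close> also kills coordinate 4, making
    \<open>E 1\<close> a multiple of \<open>E 5\<close>.\<close>
  have D: "D \<noteq> 0"
  proof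
    assume "D = 0"
    then have "E 1 = (E 1 $ 5 / A^5) *s E 5"
      using E1 E5 A by (simp add: vec6_eq_iff D_def)
    then have "std_basis 1 = (E 1 $ 5 / A^5) *s std_basis 5"
      using injD [OF f, of "std_basis 1" "(E 1 $ 5 / A^5) *s std_basis 5"]
      unfolding E_def f_scale by blast
    then show False by (simp add: std vec6_eq_iff)
  qed
  have r3: "D * b3 = b3' * A^2"
  proof -
    have "b3 * A * D = b3' * A^3"
      using coords(7) E3 E4 E5 E10 by (simp add: A_def D_def)
    then have "A * (D * b3) = A * (b3' * A^2)"
      unfolding pow by (simp only: mult_ac)
    then show ?thesis using A by simp
  qed
  \<comment> \<open>These free coordinates drop out: the terms in \<open>s\<close> and
    \<open>t\<close> of \<open>c4\<close> and \<open>c5\<close> cancel by \<open>r3\<close> and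
    \<open>r4\<close>.\<close>
  define s t where "s = E 0 $ 2" and "t = E 0 $ 3"
  have e23: "E 2 $ 3 = s * A + b3 * A * B"
    and e24: "E 2 $ 4 = t * A + b4 * A * B + b3 * s * B"
    using coords(1) by (simp_all add: A_def B_def s_def t_def)
  have e34: "E 3 $ 4 = E 2 $ 3 * A + b3 * A^2 * B"
    and e35: "E 3 $ 5 = E 2 $ 4 * A + b4 * A^2 * B + b3 * E 2 $ 3 * B"
    using coords(2) E2 by (simp_all add: A_def B_def)
  have e45: "E 4 $ 5 = E 3 $ 4 * A + b3 * A^3 * B"
    using coords(3) E3 by (simp_all add: A_def B_def)
  have c4: "b4 * A * D + b3 * s * D = b3' * E 3 $ 4 + b4' * A^4"
    using coords(7) E4 E5 E1 by (simp add: A_def B_def D_def s_def)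
  have c5: "b5 * A * D + g * B * D + b4 * s * D + b3 * t * D
      = b3' * E 3 $ 5 + b4' * E 4 $ 5 + b5' * A^5"
    using coords(7) E5 E1 by (simp add: A_def B_def D_def s_def t_def)
  have r4: "D * b4 = 2 * A * B * b3 * b3' + b4' * A^3"
  proof -
    have "A * (D * b4) = A * (2 * A * B * b3 * b3' + b4' * A^3)"
      using c4 r3 unfolding e34 e23 by algebra
    then show ?thesis using A by simp
  qed
  have r5: "D * (A * b5 + B * g) =
       A * (b3' * (B^2 * b3^2 + 2 * A * B * b4) + 3 * b4' * A^2 * B * b3 + b5' * A^4)"
    using c5 r3 r4 unfolding e45 e35 e34 e24 e23 by algebra
  have r6: "D^2 * g = g' * A^5"
    using coords(6) E5 E1 by (auto simp: D_def power2_eq_square mult_ac)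
  show thesis using that [OF A D r3 r4 r5 r6] .
qed

lemma sleib6_list_L_iso_imp_eq:
  assumes "p \<in> sleib6_list" "q \<in> sleib6_list" "L_iso p q"
  shows "p = q"
proof -
  obtain b3' b4' b5' g' where p: "p = (b3', b4', b5', g')" by (cases p) auto
  obtain b3 b4 b5 g where q: "q = (b3, b4, b5, g)" by (cases q) auto
  obtain A B D where AD: "A \<noteq> 0" "D \<noteq> 0" and r: "D * b3 = b3' * A^2"
    "D * b4 = 2 * A * B * b3 * b3' + b4' * A^3"
    "D * (A * b5 + B * g) =
       A * (b3' * (B^2 * b3^2 + 2 * A * B * b4) + 3 * b4' * A^2 * B * b3 + b5' * A^4)"
    "D^2 * g = g' * A^5"
    using assms(3) unfolding p q by (rule L_iso_relations)
  \<comment> \<open>On the list \<open>b3\<close> and \<open>g\<close> are 0 or 1, and their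
    vanishing is invariant.\<close>
  have 1: "b3 = b3'"
    using assms(1,2) r(1) AD unfolding p q sleib6_list_def by auto
  have 2: "g = g'"
    using assms(1,2) r(4) AD unfolding p q sleib6_list_def by auto
  \<comment> \<open>For \<open>b3 = 1\<close> the list has \<open>b4 = 0\<close>; for
    \<open>b3 = 0\<close> the relation is \<open>D * b4 = b4' * A^3\<close>.\<close>
  have 3: "b4 = b4'"
    using assms(1,2) r(2) AD 1 unfolding p q sleib6_list_def by auto
  show ?thesis
  proof (cases "b3 = 1 \<and> g = 1")
    \<comment> \<open>The one-parameter family: \<open>B = 0\<close> and \<open>A = D = 1\<close>
      are forced, so its parameter is an invariant.\<close>
    case True
    then have b4: "b4 = 0" "b4' = 0"
      using assms(1,2) 1 2 unfolding p q sleib6_list_def by auto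
    then have B: "B = 0" using r(2) True 1 AD by simp
    have "D = A^2" "D^2 = A^5" using r True 1 2 by simp_all
    then have "A = 1" using AD by (simp add: eval_nat_numeral)
    then have "b5 = b5'" using r(3) b4 B \<open>D = A^2\<close> by simp
    then show ?thesis using 1 2 3 p q by simp
  next
    case False
    \<comment> \<open>Either \<open>b5\<close> is 0 by the list, or \<open>g = 0\<close> and
      \<open>r(3)\<close> becomes \<open>D * A * b5 = b5' * A^5\<close>, since \<open>b3 = 1\<close>
      forces \<open>B = 0\<close>.\<close>
    then have "b5 = b5'"
      using assms(1,2) r(2,3) AD 1 2 3 unfolding p q sleib6_list_def by auto
    then show ?thesis using 1 2 3 p q by simp
  qed
qed

section \<open>From an abstract algebra to the coordinate model\<close>

lemma sleib6_L_iso: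
  assumes "sleib6 sc br"
  obtains p where "leibniz_iso (*s) (L_bracket p) sc br"
proof -
  interpret sleib6 sc br by fact
  obtain e p where inj: "inj_on e {0..5}" and ind: "independent (e ` {0..5})"
    and span: "span (e ` {0..5}) = UNIV"
    and table: "\<And>i j. i \<le> 5 \<Longrightarrow> j \<le> 5 \<Longrightarrow> br (e i) (e j) = sleib_table sc e p i j"
    using sleib_basis by metis
  obtain b3 b4 b5 g where p: "p = (b3, b4, b5, g)" by (cases p) auto
  define f where "f v = (\<Sum>i\<le>5. sc (v $ of_nat i) (e i))" for v :: "complex^6"
  have lin: "Vector_Spaces.linear (*s) sc f"
    unfolding f_def
    by (simp add: Vector_Spaces.linear_iff vec.vector_space_axioms vector_space_axioms
        scale_left_distrib sum.distrib scale_sum_right)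
  have br_sum_left: "br (sum u S) y = (\<Sum>i\<in>S. br (u i) y)" for u :: "nat \<Rightarrow> _" and S y
    using module_hom.sum [OF linear_left [unfolded linear_iff_module_hom]] by blast
  have br_sum_right: "br x (sum u S) = (\<Sum>i\<in>S. br x (u i))" for u :: "nat \<Rightarrow> _" and S x
    using module_hom.sum [OF linear_right [unfolded linear_iff_module_hom]] by blast
  have br_scale: "br (sc c x) y = sc c (br x y)" "br x (sc c y) = sc c (br x y)" for c x y
    using linear_left linear_right by (simp_all add: Vector_Spaces.linear_iff)
  have f0: "f 0 = 0" by (simp add: f_def)
  have f_table: "f (sleib_table (*s) std_basis p i j) = sleib_table sc e p i j"
    if "i \<le> 5" "j \<le> 5" for i j
  proof -
    have basis: "f (std_basis k) = e k" if "k \<le> 5" for k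
    proof -
      have "k \<in> {0, 1, 2, 3, 4, 5}" using that by auto
      then show ?thesis
        by (auto simp: f_def std_basis_def axis_def eval_nat_numeral atMost_Suc)
    qed
    show ?thesis
      using that lin unfolding p Vector_Spaces.linear_iff by (auto simp: basis f0)
  qed
  have hom: "f (L_bracket p x y) = br (f x) (f y)" for x y
  proof -
    have "f (L_bracket p x y) = (\<Sum>i\<le>5. \<Sum>j\<le>5.
        sc (x $ of_nat i * y $ of_nat j) (f (sleib_table (*s) std_basis p i j)))"
      unfolding L_bracket_def module_hom.sum [OF lin [unfolded linear_iff_module_hom]]
        module_hom.scale [OF lin [unfolded linear_iff_module_hom]] ..
    also have "\<dots> = (\<Sum>i\<le>5. \<Sum>j\<le>5. sc (x $ of_nat i * y $ of_nat j) (br (e i) (e j)))"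
      by (intro sum.cong refl) (simp add: f_table table)
    also have "\<dots> = br (f x) (f y)"
      unfolding f_def br_sum_left br_sum_right br_scale
      by (subst sum.swap) (simp add: scale_sum_right mult.commute)
    finally show ?thesis .
  qed
  have reindex: "(\<Sum>v\<in>e ` {0..5}. sc (u v) v) = (\<Sum>i\<le>5. sc (u (e i)) (e i))" for u
    using inj by (simp add: sum.reindex atLeast0AtMost)
  have "x = 0" if "f x = 0" for x
  proof -
    \<comment> \<open>Independence speaks of coefficients indexed by vectors, so the coordinates of
      \<open>x\<close> are carried along the inverse of \<open>e\<close>.\<close>
    define u where "u v = x $ of_nat (inv_into {0..5} e v)" for v
    have u: "u (e i) = x $ of_nat i" if "i \<le> 5" for i
      using inj that by (simp add: u_def)
    have "(\<Sum>v\<in>e ` {0..5}. sc (u v) v) = 0"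
      using that u unfolding reindex f_def by (simp cong: sum.cong_simp)
    then have "u v = 0" if "v \<in> e ` {0..5}" for v
      using independentD [OF ind _ subset_refl] that by simp
    then have "x $ of_nat i = 0" if "i \<le> 5" for i
      using u that by force
    from this [of 0] this [of 1] this [of 2] this [of 3] this [of 4] this [of 5]
    show "x = 0" by (simp add: vec6_eq_iff)
  qed
  then have "inj f"
    by (simp add: module_hom.inj_iff_eq_0 [OF lin [unfolded linear_iff_module_hom]])
  moreover have "surj f"
  unfolding surj_def
  proof
    fix y
    obtain u where "y = (\<Sum>v\<in>e ` {0..5}. sc (u v) v)"
      using span span_finite [of "e ` {0..5}"] by auto
    then have "y = f (vec6 (u (e 0)) (u (e 1)) (u (e 2)) (u (e 3)) (u (e 4)) (u (e 5)))"
      unfolding reindex f_def by (simp add: eval_nat_numeral atMost_Suc)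
    then show "\<exists>x. y = f x" ..
  qed
  ultimately have "leibniz_iso (*s) (L_bracket p) sc br"
    using lin hom unfolding leibniz_iso_def bij_def by blast
  then show thesis by (rule that)
qed

theorem theorem5p1:
  fixes sc :: "complex \<Rightarrow> 'v::ab_group_add \<Rightarrow> 'v"
    and br :: "'v \<Rightarrow> 'v \<Rightarrow> 'v"
  shows "(sleib6 sc br \<longrightarrow> (\<exists>p\<in>sleib6_list. leibniz_iso sc br (*s) (L_bracket p))) \<and>
    (\<forall>p\<in>sleib6_list. leibniz_algebra (*s) (L_bracket p)) \<and>
    (\<forall>p\<in>sleib6_list. \<forall>q\<in>sleib6_list. p \<noteq> q \<longrightarrow>
       \<not> leibniz_iso (*s) (L_bracket p) (*s) (L_bracket q))"
proof (intro conjI impI ballI)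
  assume "sleib6 sc br"
  then obtain p where p: "leibniz_iso (*s) (L_bracket p) sc br" by (rule sleib6_L_iso)
  obtain q where "q \<in> sleib6_list" "L_iso p q" using L_iso_sleib6_list by blast
  with leibniz_iso_trans [OF leibniz_iso_sym [OF p]]
  show "\<exists>p\<in>sleib6_list. leibniz_iso sc br (*s) (L_bracket p)" by blast
qed (use leibniz_algebra_L_bracket sleib6_list_L_iso_imp_eq in blast)+

end
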